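(* Let $\Gamma$ be a locally finite connected graph and let $\{\xi_i\}_{i=1}^\infty$ be a sequence of i.i.d. random $\Gamma$-elements. If the weight function $M_{\xi_1}$ is totally defined and $\mathbb{E}(\xi_1)=\{v\}$ for some $v\in V(\Gamma)$, then $$\lim_{n\to\infty}\mathbb{S}(\xi_1,\dots,\xi_n)=\mathbb{E}(\xi_1)$$ with probability one.
   Context: Let $(\Omega,\mathcal{F},\mathbf{P})$ be a probability space and let $d$ be the graph distance on $V(\Gamma)$. A random $\Gamma$-element is a measurable function $\xi:\Omega\to V(\Gamma)$ (with $V(\Gamma)$ discrete); its distribution is $\mu_\xi(v)=\mathbf{P}(\xi=v)$. The weight function is $M_\xi(v)=\sum_{s\in V(\Gamma)}d^2(v,s)\mu_\xi(s)$; it is totally defined if $M_\xi(v)<\infty$ for all $v\in V(\Gamma)$. In that case the mean-set of $\xi$ is $\mathbb{E}(\xi)=\{v\in V(\Gamma)\mid M_\xi(v)\le M_\xi(u)\ \forall u\in V(\Gamma)\}$. For a sample $\xi_1,\dots,\xi_n$ put $\mu_n(u)=\frac1n|\{i\mid 1\le i\le n,\ \xi_i=u\}|$ and $M_n(v)=\sum_{s\in V(\Gamma)}d^2(v,s)\mu_n(s)$. The sample mean-set is $\mathbb{S}(\xi_1,\dots,\xi_n)=\{v\in V(\Gamma)\mid M_n(v)\le M_n(u)\ \forall u\in V(\Gamma)\}$ (a random set). Limits of sequences of sets are set-theoretic: $\limsup_n A_n$ is the set of points lying in $A_n$ for infinitely many $n$, $\liminf_n A_n$ is the set of points lying in $A_n$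 for all sufficiently large $n$, and $\lim_n A_n=A$ means that both equal $A$. *)

theory Defs
  imports "HOL-Probability.Probability" "Graph_Theory.Graph_Theory"
begin

text \<open>
  An undirected graph, possibly infinite, is a symmetric digraph without parallel arcs: an edge
  between \<open>u\<close> and \<open>v\<close> is the pair of arcs \<open>(u, v)\<close> and \<open>(v, u)\<close>.
  Loops are allowed; they do not influence distances.
\<close>

definition locally_finite_graph :: "'v pair_pre_digraph \<Rightarrow> bool" where
  "locally_finite_graph G \<longleftrightarrow> (\<forall>v \<in> pverts G. finite (out_arcs (with_proj G) v))"

definition graph_dist :: "'v pair_pre_digraph \<Rightarrow> 'v \<Rightarrow> 'v \<Rightarrow> real" where
  "graph_dist G u v = real_of_ereal (wf_digraph.\<mu> (with_proj G) (\<lambda>_. 1) u v)"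

lemma graph_dist_eq_shortest_walk:
  assumes "wf_digraph (with_proj G)" "u \<rightarrow>\<^sup>*\<^bsub>with_proj G\<^esub> v"
  shows "graph_dist G u v = real (LEAST n. \<exists>p. pre_digraph.awalk (with_proj G) u p v \<and> length p = n)"
proof -
  interpret wf_digraph "with_proj G" by fact
  define n where "n = (LEAST n. \<exists>p. awalk u p v \<and> length p = n)"
  have cost: "awalk_cost (\<lambda>_. 1) p = real (length p)" for p
    by (induction p) auto
  obtain p0 where "awalk u p0 v"
    using assms(2) by (auto simp: reachable_awalk)
  then have ex: "\<exists>n p. awalk u p v \<and> length p = n"
    by blast
  obtain p where p: "awalk u p v" "length p = n"
    using LeastI_ex[OF ex] unfolding n_def by blast
  have min: "n \<le> length q" if "awalk u q v" for q
    unfolding n_def using that by (intro Least_le) blast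
  have "\<mu> (\<lambda>_. 1) u v = ereal (real n)"
    unfolding \<mu>_def
  proof (rule antisym)
    show "(INF p\<in>{p. awalk u p v}. ereal (awalk_cost (\<lambda>_. 1) p)) \<le> ereal (real n)"
      using p by (intro INF_lower2[of p]) (auto simp: cost)
    show "ereal (real n) \<le> (INF p\<in>{p. awalk u p v}. ereal (awalk_cost (\<lambda>_. 1) p))"
      using min by (intro INF_greatest) (auto simp: cost)
  qed
  then show ?thesis
    by (simp add: graph_dist_def n_def)
qed

text \<open>The value is \<open>\<infinity>\<close> when the series diverges.\<close>

definition weight :: "'v pair_pre_digraph \<Rightarrow> ('v \<Rightarrow> real) \<Rightarrow> 'v \<Rightarrow> ennreal" where
  "weight G m v = (\<Sum>\<^sub>\<infinity>s\<in>pverts G. ennreal ((graph_dist G v s)\<^sup>2 * m s))"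

definition weight_minimizers :: "'v pair_pre_digraph \<Rightarrow> ('v \<Rightarrow> real) \<Rightarrow> 'v set" where
  "weight_minimizers G m = {v \<in> pverts G. \<forall>u \<in> pverts G. weight G m v \<le> weight G m u}"

definition element_dist :: "'w measure \<Rightarrow> ('w \<Rightarrow> 'v) \<Rightarrow> 'v \<Rightarrow> real" where
  "element_dist P \<xi> v = measure P {\<omega> \<in> space P. \<xi> \<omega> = v}"

definition weight_totally_defined ::
    "'v pair_pre_digraph \<Rightarrow> 'w measure \<Rightarrow> ('w \<Rightarrow> 'v) \<Rightarrow> bool" where
  "weight_totally_defined G P \<xi> \<longleftrightarrow> (\<forall>v \<in> pverts G. weight G (element_dist P \<xi>) v < \<infinity>)"

definition mean_set :: "'v pair_pre_digraph \<Rightarrow> 'w measure \<Rightarrow> ('w \<Rightarrow> 'v) \<Rightarrow> 'v set" where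
  "mean_set G P \<xi> = weight_minimizers G (element_dist P \<xi>)"

text \<open>Samples are indexed from \<open>1\<close>: the first \<open>n\<close> elements are \<open>\<xi> 1, \<dots>, \<xi> n\<close>.\<close>

definition sample_freq :: "(nat \<Rightarrow> 'w \<Rightarrow> 'v) \<Rightarrow> nat \<Rightarrow> 'w \<Rightarrow> 'v \<Rightarrow> real" where
  "sample_freq \<xi> n \<omega> u = real (card {i \<in> {1..n}. \<xi> i \<omega> = u}) / real n"

definition sample_mean_set ::
    "'v pair_pre_digraph \<Rightarrow> (nat \<Rightarrow> 'w \<Rightarrow> 'v) \<Rightarrow> nat \<Rightarrow> 'w \<Rightarrow> 'v set" where
  "sample_mean_set G \<xi> n \<omega> = weight_minimizers G (sample_freq \<xi> n \<omega>)"

text \<open>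
  On sets, the lattice operations \<open>limsup\<close> and \<open>liminf\<close> are the set-theoretic ones.
\<close>

lemma limsup_set_eq: "limsup A = {x. \<exists>\<^sub>\<infinity>n. x \<in> A n}"
  for A :: "nat \<Rightarrow> 'a set"
  by (auto simp: limsup_INF_SUP INFM_nat_le)

lemma liminf_set_eq: "liminf A = {x. \<forall>\<^sub>\<infinity>n. x \<in> A n}"
  for A :: "nat \<Rightarrow> 'a set"
  by (auto simp: liminf_SUP_INF MOST_nat_le)

end

theory Submission
  imports Defs
begin

text \<open>
  Write \<open>d\<close> for the graph distance and \<open>f u s = (d u s)\<^sup>2 - (d v s)\<^sup>2\<close>. A vertex
  \<open>u\<close> loses against \<open>v\<close> in the sample mean-set at time \<open>n\<close> exactly when the average of
  \<open>f u (\<xi> i)\<close> over \<open>1 \<le> i \<le> n\<close> is positive, and \<open>v\<close> being the only minimizer of the weight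
  means that the expectation of \<open>f u (\<xi> 1)\<close> is positive for every \<open>u \<noteq> v\<close>. So a law of large
  numbers makes each single \<open>u\<close> lose from some time on; the point is to find one time for all
  \<open>u\<close>.

  Vertices far from \<open>v\<close> are handled together. With \<open>D = d v u\<close> the triangle inequality gives
  \<open>f u s \<ge> D (D - 2 d v s)\<close>, so \<open>u\<close> loses as soon as the average of \<open>d v (\<xi> i)\<close> is below
  \<open>D / 2\<close>. Since these averages converge to some \<open>c\<close>, all \<open>u\<close> with \<open>D > 2 c + 1\<close> lose
  from a common time on. The remaining vertices lie in a ball, which is finite because the graph is
  locally finite, so finitely many limits suffice there. This deterministic argument is
  \<open>eventually_sum_sq_dist_less\<close>.

  Finiteness of the weights says that \<open>d u (\<xi> 1)\<close> is square integrable. The variable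
  \<open>f u (\<xi> 1)\<close> is a difference of squares, but it is square integrable too, because the first factor
  of \<open>(d u s - d v s) (d u s + d v s)\<close> is at most \<open>D\<close> in absolute value. Hence the strong law is needed only for
  square integrable variables (\<open>strong_law_iid\<close>), where second moments along the subsequence of
  square numbers are enough.
\<close>

section \<open>A strong law of large numbers for square integrable variables\<close>

text \<open>
  Consecutive squares have ratio tending to 1 and the partial sums increase. The average at
  \<open>n\<close> therefore lies between the averages at the two squares around \<open>n\<close>, up to factors that
  tend to 1.
\<close>

lemma averages_tendsto_if_along_squares:
  fixes a :: "nat \<Rightarrow> real"
  assumes nonneg: "\<And>i. i \<ge> 1 \<Longrightarrow> 0 \<le> a i"
    and lim: "(\<lambda>k. (\<Sum>i=1..k\<^sup>2. a i) / real (k\<^sup>2)) \<longlonglongrightarrow> m"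
  shows "(\<lambda>n. (\<Sum>i=1..n. a i) / real n) \<longlonglongrightarrow> m"
proof -
  define S where "S n = (\<Sum>i=1..n. a i)" for n
  define A where "A k = S (k\<^sup>2) / real (k\<^sup>2)" for k
  define k where "k n = nat \<lfloor>sqrt (real n)\<rfloor>" for n
  have S_mono: "S n \<le> S n'" if "n \<le> n'" for n n'
    unfolding S_def using that nonneg by (intro sum_mono2) auto
  have S_nonneg: "0 \<le> S n" for n
    unfolding S_def using nonneg by (intro sum_nonneg) auto
  have k_lim: "filterlim k sequentially sequentially"
    unfolding k_def filterlim_sequentially_iff_filterlim_real
    by real_asymp
  have A_lim: "A \<longlonglongrightarrow> m"
    using lim by (simp add: A_def [abs_def] S_def)
  have low: "(\<lambda>j. A j * (real j / (real j + 1))\<^sup>2) \<longlonglongrightarrow> m"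
  proof -
    have "(\<lambda>j. (real j / (real j + 1))\<^sup>2) \<longlonglongrightarrow> 1"
      by real_asymp
    from tendsto_mult[OF A_lim this] show ?thesis by simp
  qed
  have up: "(\<lambda>j. A (Suc j) * ((real j + 1) / real j)\<^sup>2) \<longlonglongrightarrow> m"
  proof -
    have "(\<lambda>j. ((real j + 1) / real j)\<^sup>2) \<longlonglongrightarrow> 1"
      by real_asymp
    from tendsto_mult[OF LIMSEQ_Suc[OF A_lim] this] show ?thesis by simp
  qed
  have k_bounds: "(k n)\<^sup>2 \<le> n" "n \<le> (Suc (k n))\<^sup>2" for n
  proof -
    have r: "real (k n) \<le> sqrt (real n)" "sqrt (real n) \<le> real (k n) + 1"
      unfolding k_def by (simp_all add: of_nat_nat floor_le_iff)
    have "(real (k n))\<^sup>2 \<le> (sqrt (real n))\<^sup>2"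
      using r(1) by (intro power_mono) auto
    then have "real ((k n)\<^sup>2) \<le> real n"
      by simp
    then show "(k n)\<^sup>2 \<le> n"
      by (simp only: of_nat_le_iff)
    have "(sqrt (real n))\<^sup>2 \<le> (real (k n) + 1)\<^sup>2"
      using r(2) by (intro power_mono) auto
    then have "real n \<le> real ((Suc (k n))\<^sup>2)"
      by (simp add: add.commute)
    then show "n \<le> (Suc (k n))\<^sup>2"
      by (simp only: of_nat_le_iff)
  qed
  have ev: "\<forall>\<^sub>F n in sequentially. 0 < k n \<and> 0 < n"
    using eventually_compose_filterlim[OF eventually_gt_at_top[of 0] k_lim] eventually_gt_at_top[of 0]
    by eventually_elim auto
  have "(\<lambda>n. S n / real n) \<longlonglongrightarrow> m"
  proof (rule tendsto_sandwich)
    show "(\<lambda>n. A (k n) * (real (k n) / (real (k n) + 1))\<^sup>2) \<longlonglongrightarrow> m"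
      by (rule filterlim_compose[OF low k_lim])
    show "(\<lambda>n. A (Suc (k n)) * ((real (k n) + 1) / real (k n))\<^sup>2) \<longlonglongrightarrow> m"
      by (rule filterlim_compose[OF up k_lim])
    show "\<forall>\<^sub>F n in sequentially. A (k n) * (real (k n) / (real (k n) + 1))\<^sup>2 \<le> S n / real n"
      using ev
    proof eventually_elim
      case (elim n)
      have "A (k n) * (real (k n) / (real (k n) + 1))\<^sup>2 = S ((k n)\<^sup>2) / real ((Suc (k n))\<^sup>2)"
        using elim by (simp add: A_def power_divide add.commute)
      also have "\<dots> \<le> S n / real n"
        using elim k_bounds[of n] S_nonneg S_mono
        by (intro frac_le) (auto simp del: of_nat_power)
      finally show ?case .
    qed
    show "\<forall>\<^sub>F n in sequentially. S n / real n \<le> A (Suc (k n)) * ((real (k n) + 1) / real (k n))\<^sup>2"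
      using ev
    proof eventually_elim
      case (elim n)
      have "S n / real n \<le> S ((Suc (k n))\<^sup>2) / real ((k n)\<^sup>2)"
        using elim k_bounds[of n] S_nonneg S_mono
        by (intro frac_le) (auto simp del: of_nat_power)
      also have "\<dots> = A (Suc (k n)) * ((real (k n) + 1) / real (k n))\<^sup>2"
      proof -
        have "real (k n) + 1 \<noteq> 0" by linarith
        then show ?thesis
          using elim by (simp add: A_def power_divide add.commute)
      qed
      finally show ?case .
    qed
  qed
  then show ?thesis by (simp add: S_def)
qed

context prob_space
begin

lemma integrable_mult_of_square_integrable:
  fixes X Y :: "'a \<Rightarrow> real"
  assumes [measurable]: "X \<in> borel_measurable M" "Y \<in> borel_measurable M"
    and "integrable M (\<lambda>x. (X x)\<^sup>2)" "integrable M (\<lambda>x. (Y x)\<^sup>2)"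
  shows "integrable M (\<lambda>x. X x * Y x)"
proof (rule Bochner_Integration.integrable_bound)
  show "integrable M (\<lambda>x. (X x)\<^sup>2 + (Y x)\<^sup>2)"
    using assms by auto
  have "\<bar>a * b\<bar> \<le> a\<^sup>2 + b\<^sup>2" for a b :: real
    using zero_le_power2[of "\<bar>a\<bar> - \<bar>b\<bar>"] zero_le_power2[of a] zero_le_power2[of b]
    unfolding power2_diff power2_abs abs_mult by linarith
  then show "AE x in M. norm (X x * Y x) \<le> norm ((X x)\<^sup>2 + (Y x)\<^sup>2)"
    by (auto intro!: AE_I2)
qed auto

lemma second_moment_uncorrelated_sum:
  fixes Y :: "'i \<Rightarrow> 'a \<Rightarrow> real"
  assumes "finite I"
    and meas: "\<And>i. i \<in> I \<Longrightarrow> Y i \<in> borel_measurable M"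
    and sq: "\<And>i. i \<in> I \<Longrightarrow> integrable M (\<lambda>x. (Y i x)\<^sup>2)"
    and uncorr: "\<And>i j. i \<in> I \<Longrightarrow> j \<in> I \<Longrightarrow> i \<noteq> j \<Longrightarrow> expectation (\<lambda>x. Y i x * Y j x) = 0"
  shows "integrable M (\<lambda>x. (\<Sum>i\<in>I. Y i x)\<^sup>2)"
    and "expectation (\<lambda>x. (\<Sum>i\<in>I. Y i x)\<^sup>2) = (\<Sum>i\<in>I. expectation (\<lambda>x. (Y i x)\<^sup>2))"
proof -
  have int: "integrable M (\<lambda>x. Y i x * Y j x)" if "i \<in> I" "j \<in> I" for i j
    using that by (intro integrable_mult_of_square_integrable meas sq)
  have expand: "(\<Sum>i\<in>I. Y i x)\<^sup>2 = (\<Sum>i\<in>I. \<Sum>j\<in>I. Y i x * Y j x)" for x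
    by (simp add: power2_eq_square sum_product)
  show "integrable M (\<lambda>x. (\<Sum>i\<in>I. Y i x)\<^sup>2)"
    unfolding expand by (intro Bochner_Integration.integrable_sum int)
  have "expectation (\<lambda>x. (\<Sum>i\<in>I. Y i x)\<^sup>2) = (\<Sum>i\<in>I. \<Sum>j\<in>I. expectation (\<lambda>x. Y i x * Y j x))"
    unfolding expand
    by (simp add: int Bochner_Integration.integral_sum Bochner_Integration.integrable_sum)
  also have "\<dots> = (\<Sum>i\<in>I. expectation (\<lambda>x. Y i x * Y i x))"
  proof (rule sum.cong[OF refl])
    fix i assume i: "i \<in> I"
    have "(\<Sum>j\<in>I. expectation (\<lambda>x. Y i x * Y j x))
        = (\<Sum>j\<in>I. if j = i then expectation (\<lambda>x. Y i x * Y i x) else 0)"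
      using i uncorr by (intro sum.cong) auto
    then show "(\<Sum>j\<in>I. expectation (\<lambda>x. Y i x * Y j x)) = expectation (\<lambda>x. Y i x * Y i x)"
      using i \<open>finite I\<close> by simp
  qed
  finally show "expectation (\<lambda>x. (\<Sum>i\<in>I. Y i x)\<^sup>2) = (\<Sum>i\<in>I. expectation (\<lambda>x. (Y i x)\<^sup>2))"
    by (simp add: power2_eq_square)
qed

text \<open>
  The expectation of \<open>\<Sum>k. (Z k)\<^sup>2\<close> is finite, so this series converges almost surely, and its
  terms tend to 0. This replaces the usual combination of Chebyshev and Borel--Cantelli.
\<close>

lemma AE_tendsto_0_of_summable_second_moments:
  fixes Z :: "nat \<Rightarrow> 'a \<Rightarrow> real"
  assumes meas [measurable]: "\<And>k. Z k \<in> borel_measurable M"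
    and int: "\<And>k. integrable M (\<lambda>x. (Z k x)\<^sup>2)"
    and summ: "summable (\<lambda>k. expectation (\<lambda>x. (Z k x)\<^sup>2))"
  shows "AE x in M. (\<lambda>k. Z k x) \<longlonglongrightarrow> 0"
proof -
  have "(\<integral>\<^sup>+x. (\<Sum>k. ennreal ((Z k x)\<^sup>2)) \<partial>M) = (\<Sum>k. \<integral>\<^sup>+x. ennreal ((Z k x)\<^sup>2) \<partial>M)"
    by (rule nn_integral_suminf) measurable
  also have "\<dots> = (\<Sum>k. ennreal (expectation (\<lambda>x. (Z k x)\<^sup>2)))"
    by (simp add: nn_integral_eq_integral[OF int])
  also have "\<dots> = ennreal (\<Sum>k. expectation (\<lambda>x. (Z k x)\<^sup>2))"
    by (rule suminf_ennreal2[OF _ summ]) simp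
  finally have fin: "(\<integral>\<^sup>+x. (\<Sum>k. ennreal ((Z k x)\<^sup>2)) \<partial>M) \<noteq> \<infinity>"
    by simp
  have "AE x in M. (\<Sum>k. ennreal ((Z k x)\<^sup>2)) \<noteq> \<infinity>"
    by (rule nn_integral_noteq_infinite[OF _ fin]) measurable
  then show ?thesis
  proof eventually_elim
    case (elim x)
    then have "summable (\<lambda>k. (Z k x)\<^sup>2)"
      by (intro summable_suminf_not_top) (simp_all add: top_ennreal_def)
    then have "(\<lambda>k. sqrt ((Z k x)\<^sup>2)) \<longlonglongrightarrow> sqrt 0"
      by (intro tendsto_real_sqrt summable_LIMSEQ_zero)
    then show ?case
      by (simp add: tendsto_rabs_zero_iff)
  qed
qed

text \<open>
  The centred average over \<open>n\<close> variables has second moment at most \<open>q / n\<close>. This is not summable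
  over all \<open>n\<close>, but it is over the squares \<open>n = k\<^sup>2\<close>; nonnegativity then fills the gaps
  between squares.
\<close>

lemma strong_law_nonneg_uncorrelated:
  fixes X :: "nat \<Rightarrow> 'a \<Rightarrow> real"
  assumes meas [measurable]: "\<And>i. i \<ge> 1 \<Longrightarrow> X i \<in> borel_measurable M"
    and nonneg: "\<And>i x. i \<ge> 1 \<Longrightarrow> x \<in> space M \<Longrightarrow> 0 \<le> X i x"
    and sq: "\<And>i. i \<ge> 1 \<Longrightarrow> integrable M (\<lambda>x. (X i x)\<^sup>2)"
    and mean: "\<And>i. i \<ge> 1 \<Longrightarrow> expectation (X i) = m"
    and bound: "\<And>i. i \<ge> 1 \<Longrightarrow> expectation (\<lambda>x. (X i x)\<^sup>2) \<le> q"
    and uncorr: "\<And>i j. i \<ge> 1 \<Longrightarrow> j \<ge> 1 \<Longrightarrow> i \<noteq> j \<Longrightarrow> expectation (\<lambda>x. X i x * X j x) = m\<^sup>2"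
  shows "AE x in M. (\<lambda>n. (\<Sum>i=1..n. X i x) / real n) \<longlonglongrightarrow> m"
proof -
  define Y where "Y i x = X i x - m" for i x
  \<comment> \<open>For \<open>k = 0\<close> the average is 0 by division by zero; only its limit matters.\<close>
  define Z where "Z k x = (\<Sum>i=1..k\<^sup>2. Y i x) / real (k\<^sup>2)" for k x
  have X_int: "integrable M (X i)" if "i \<ge> 1" for i
    by (rule square_integrable_imp_integrable[OF meas[OF that] sq[OF that]])
  have XX_int: "integrable M (\<lambda>x. X i x * X j x)" if "i \<ge> 1" "j \<ge> 1" for i j
    using that by (intro integrable_mult_of_square_integrable meas sq)
  have YY: "Y i x * Y j x = X i x * X j x - m * X i x - m * X j x + m\<^sup>2" for i j x
    by (simp add: Y_def algebra_simps power2_eq_square)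
  have Y_meas: "Y i \<in> borel_measurable M" if "i \<ge> 1" for i
    using meas[OF that] unfolding Y_def by measurable
  have YY_int: "integrable M (\<lambda>x. Y i x * Y j x)" if "i \<ge> 1" "j \<ge> 1" for i j
    unfolding YY using that X_int XX_int by auto
  have YY_exp: "expectation (\<lambda>x. Y i x * Y j x) = expectation (\<lambda>x. X i x * X j x) - m\<^sup>2"
    if "i \<ge> 1" "j \<ge> 1" for i j
    unfolding YY using that X_int XX_int
    by (simp add: prob_space mean power2_eq_square)
  have Y_sq: "integrable M (\<lambda>x. (Y i x)\<^sup>2)" if "i \<ge> 1" for i
    using YY_int[of i i] that by (simp add: power2_eq_square)
  have Z_meas: "Z k \<in> borel_measurable M" for k
    unfolding Z_def using Y_meas by (intro borel_measurable_divide borel_measurable_sum) auto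
  note sum_sq = second_moment_uncorrelated_sum[of "{1..n}" Y for n]
  have Y_uncorr: "expectation (\<lambda>x. Y i x * Y j x) = 0" if "i \<ge> 1" "j \<ge> 1" "i \<noteq> j" for i j
    using that by (simp add: YY_exp uncorr)
  have S_int: "integrable M (\<lambda>x. (\<Sum>i=1..n. Y i x)\<^sup>2)" for n
    using Y_meas Y_sq Y_uncorr by (intro sum_sq) auto
  have S_bound: "expectation (\<lambda>x. (\<Sum>i=1..n. Y i x)\<^sup>2) \<le> real n * q" for n
  proof -
    have "expectation (\<lambda>x. (\<Sum>i=1..n. Y i x)\<^sup>2) = (\<Sum>i=1..n. expectation (\<lambda>x. (Y i x)\<^sup>2))"
      using Y_meas Y_sq Y_uncorr by (intro sum_sq) auto
    also have "\<dots> \<le> (\<Sum>i=1..n. q)"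
    proof (rule sum_mono)
      fix i assume i: "i \<in> {1..n}"
      then have "expectation (\<lambda>x. (Y i x)\<^sup>2) = expectation (\<lambda>x. (X i x)\<^sup>2) - m\<^sup>2"
        using YY_exp[of i i] by (simp add: power2_eq_square)
      also have "\<dots> \<le> expectation (\<lambda>x. (X i x)\<^sup>2)"
        by simp
      also have "\<dots> \<le> q"
        using bound[of i] i by simp
      finally show "expectation (\<lambda>x. (Y i x)\<^sup>2) \<le> q" .
    qed
    finally show ?thesis by simp
  qed
  have Z_sq: "(Z k x)\<^sup>2 = (\<Sum>i=1..k\<^sup>2. Y i x)\<^sup>2 / (real (k\<^sup>2))\<^sup>2" for k x
    by (simp add: Z_def power_divide)
  have Z_int: "integrable M (\<lambda>x. (Z k x)\<^sup>2)" for k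
    unfolding Z_sq by (intro integrable_divide S_int)
  have "AE x in M. (\<lambda>k. Z k x) \<longlonglongrightarrow> 0"
  proof (rule AE_tendsto_0_of_summable_second_moments[OF Z_meas Z_int])
    show "summable (\<lambda>k. expectation (\<lambda>x. (Z k x)\<^sup>2))"
    proof (rule summable_comparison_test')
      show "summable (\<lambda>k. q * inverse ((real k)\<^sup>2))"
        by (intro summable_mult inverse_power_summable) auto
      fix k :: nat
      assume "k \<ge> 1"
      have "expectation (\<lambda>x. (Z k x)\<^sup>2) = expectation (\<lambda>x. (\<Sum>i=1..k\<^sup>2. Y i x)\<^sup>2) / (real (k\<^sup>2))\<^sup>2"
        unfolding Z_sq by simp
      also have "\<dots> \<le> (real (k\<^sup>2) * q) / (real (k\<^sup>2))\<^sup>2"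
        by (intro divide_right_mono S_bound) auto
      also have "\<dots> = q * inverse ((real k)\<^sup>2)"
        using \<open>k \<ge> 1\<close> by (simp add: power2_eq_square divide_simps)
      finally show "norm (expectation (\<lambda>x. (Z k x)\<^sup>2)) \<le> q * inverse ((real k)\<^sup>2)"
        by simp
    qed
  qed
  then show ?thesis
    using AE_space
  proof eventually_elim
    case (elim x)
    have "(\<lambda>k. Z k x + m) \<longlonglongrightarrow> 0 + m"
      using elim by (intro tendsto_intros)
    moreover have "\<forall>\<^sub>F k in sequentially. Z k x + m = (\<Sum>i=1..k\<^sup>2. X i x) / real (k\<^sup>2)"
      using eventually_gt_at_top[of 0]
      by eventually_elim (simp add: Z_def Y_def sum_subtractf diff_divide_distrib)
    ultimately have "(\<lambda>k. (\<Sum>i=1..k\<^sup>2. X i x) / real (k\<^sup>2)) \<longlonglongrightarrow> 0 + m"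
      by (rule Lim_transform_eventually)
    then have "(\<lambda>k. (\<Sum>i=1..k\<^sup>2. X i x) / real (k\<^sup>2)) \<longlonglongrightarrow> m"
      by simp
    then show ?case
      using elim nonneg by (intro averages_tendsto_if_along_squares) auto
  qed
qed

text \<open>
  Nonnegativity is obtained by treating the positive and the negative part of \<open>f\<close> separately;
  independence enters only through the vanishing covariances.
\<close>

lemma strong_law_iid:
  fixes f :: "'b \<Rightarrow> real"
  assumes indep: "indep_vars (\<lambda>_. N) \<xi> {1::nat..}"
    and ident: "\<And>i. i \<ge> 1 \<Longrightarrow> distr M N (\<xi> i) = distr M N (\<xi> 1)"
    and f [measurable]: "f \<in> borel_measurable N"
    and sq: "integrable M (\<lambda>x. (f (\<xi> 1 x))\<^sup>2)"
  shows "AE x in M. (\<lambda>n. (\<Sum>i=1..n. f (\<xi> i x)) / real n) \<longlonglongrightarrow> expectation (\<lambda>x. f (\<xi> 1 x))"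
proof -
  have \<xi> [measurable]: "\<xi> i \<in> measurable M N" if "i \<ge> 1" for i
    using indep that by (auto simp: indep_vars_def)
  have \<xi>1 [measurable]: "\<xi> 1 \<in> measurable M N"
    by simp
  have nonneg_case: "AE x in M. (\<lambda>n. (\<Sum>i=1..n. g (\<xi> i x)) / real n)
      \<longlonglongrightarrow> expectation (\<lambda>x. g (\<xi> 1 x))"
    if g [measurable]: "g \<in> borel_measurable N" and g_nonneg: "\<And>s. 0 \<le> g s" and g_le: "\<And>s. g s \<le> \<bar>f s\<bar>"
    for g :: "'b \<Rightarrow> real"
  proof -
    have transfer: "expectation (\<lambda>x. h (\<xi> i x)) = expectation (\<lambda>x. h (\<xi> 1 x))"
      if [measurable]: "h \<in> borel_measurable N" and "i \<ge> 1" for h :: "'b \<Rightarrow> real" and i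
      using integral_distr[OF \<xi>[OF that(2)] that(1)] integral_distr[OF \<xi>1 that(1)] ident[OF that(2)]
      by simp
    have transfer_int: "integrable M (\<lambda>x. h (\<xi> i x)) \<longleftrightarrow> integrable M (\<lambda>x. h (\<xi> 1 x))"
      if [measurable]: "h \<in> borel_measurable N" and "i \<ge> 1" for h :: "'b \<Rightarrow> real" and i
      using integrable_distr_eq[OF \<xi>[OF that(2)] that(1)] integrable_distr_eq[OF \<xi>1 that(1)]
        ident[OF that(2)]
      by simp
    have g_sq1: "integrable M (\<lambda>x. (g (\<xi> 1 x))\<^sup>2)"
    proof (rule Bochner_Integration.integrable_bound[OF sq])
      show "AE x in M. norm ((g (\<xi> 1 x))\<^sup>2) \<le> norm ((f (\<xi> 1 x))\<^sup>2)"
        using g_nonneg g_le by (auto intro!: AE_I2 simp: abs_le_square_iff[symmetric])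
    qed measurable
    have g_sq: "integrable M (\<lambda>x. (g (\<xi> i x))\<^sup>2)" if "i \<ge> 1" for i
      using transfer_int[of "\<lambda>s. (g s)\<^sup>2", OF _ that] g_sq1 by simp
    have g_int: "integrable M (\<lambda>x. g (\<xi> i x))" if "i \<ge> 1" for i
      using that by (intro square_integrable_imp_integrable[OF _ g_sq]) measurable
    show ?thesis
    proof (rule strong_law_nonneg_uncorrelated)
      fix i :: nat assume i: "i \<ge> 1"
      show "(\<lambda>x. g (\<xi> i x)) \<in> borel_measurable M"
        using i by measurable
      show "integrable M (\<lambda>x. (g (\<xi> i x))\<^sup>2)"
        by (rule g_sq[OF i])
      show "expectation (\<lambda>x. g (\<xi> i x)) = expectation (\<lambda>x. g (\<xi> 1 x))"
        by (rule transfer[OF g i])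
      show "expectation (\<lambda>x. (g (\<xi> i x))\<^sup>2) \<le> expectation (\<lambda>x. (g (\<xi> 1 x))\<^sup>2)"
        using transfer[of "\<lambda>s. (g s)\<^sup>2", OF _ i] by simp
    next
      fix i j :: nat assume ij: "i \<ge> 1" "j \<ge> 1" "i \<noteq> j"
      have "indep_vars (\<lambda>_. borel) (\<lambda>i x. g (\<xi> i x)) {i, j}"
        using ij by (intro indep_vars_compose2[OF indep_vars_subset[OF indep]]) auto
      then have "expectation (\<lambda>x. \<Prod>k\<in>{i, j}. g (\<xi> k x)) = (\<Prod>k\<in>{i, j}. expectation (\<lambda>x. g (\<xi> k x)))"
        using ij g_int by (intro indep_vars_lebesgue_integral) auto
      then show "expectation (\<lambda>x. g (\<xi> i x) * g (\<xi> j x)) = (expectation (\<lambda>x. g (\<xi> 1 x)))\<^sup>2"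
        using ij transfer[OF g ij(1)] transfer[OF g ij(2)] by (simp add: power2_eq_square)
    qed (use g_nonneg in auto)
  qed
  have pos_neg: "f s = max (f s) 0 - max (- f s) 0" for s
    by simp
  have f_int: "integrable M (\<lambda>x. f (\<xi> 1 x))"
    by (intro square_integrable_imp_integrable[OF _ sq]) measurable
  have "AE x in M. (\<lambda>n. (\<Sum>i=1..n. max (f (\<xi> i x)) 0) / real n)
      \<longlonglongrightarrow> expectation (\<lambda>x. max (f (\<xi> 1 x)) 0)"
    by (rule nonneg_case) auto
  moreover have "AE x in M. (\<lambda>n. (\<Sum>i=1..n. max (- f (\<xi> i x)) 0) / real n)
      \<longlonglongrightarrow> expectation (\<lambda>x. max (- f (\<xi> 1 x)) 0)"
    by (rule nonneg_case) auto
  ultimately show ?thesis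
  proof eventually_elim
    case (elim x)
    have "expectation (\<lambda>x. f (\<xi> 1 x))
        = expectation (\<lambda>x. max (f (\<xi> 1 x)) 0 - max (- f (\<xi> 1 x)) 0)"
      by (intro Bochner_Integration.integral_cong refl pos_neg)
    also have "\<dots> = expectation (\<lambda>x. max (f (\<xi> 1 x)) 0) - expectation (\<lambda>x. max (- f (\<xi> 1 x)) 0)"
      by (intro Bochner_Integration.integral_diff integrable_max Bochner_Integration.integrable_minus
          f_int integrable_const)
    finally have "expectation (\<lambda>x. f (\<xi> 1 x))
        = expectation (\<lambda>x. max (f (\<xi> 1 x)) 0) - expectation (\<lambda>x. max (- f (\<xi> 1 x)) 0)" .
    moreover have "(\<Sum>i=1..n. f (\<xi> i x)) / real n
        = (\<Sum>i=1..n. max (f (\<xi> i x)) 0) / real n - (\<Sum>i=1..n. max (- f (\<xi> i x)) 0) / real n" for n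
      unfolding diff_divide_distrib[symmetric] sum_subtractf[symmetric]
      by (intro arg_cong2[where f="(/)"] sum.cong refl pos_neg)
    ultimately show ?case
      by (simp only: tendsto_diff[OF elim])
  qed
qed

end

section \<open>The metric of a locally finite connected graph\<close>

locale locally_finite_connected_graph = pair_sym_digraph G for G :: "'v pair_pre_digraph" +
  assumes locally_finite: "locally_finite_graph G"
    and connected: "Digraph_Component.connected (with_proj G)"
begin

lemma reachable_if_verts:
  assumes "u \<in> pverts G" "w \<in> pverts G"
  shows "u \<rightarrow>\<^sup>*\<^bsub>with_proj G\<^esub> w"
proof -
  have "u \<rightarrow>\<^sup>*\<^bsub>with_proj (mk_symmetric (with_proj G))\<^esub> w"
    using connected assms by (auto simp: Digraph_Component.connected_def strongly_connected_def)
  then show ?thesis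
    by (simp add: reachable_mk_symmetric_eq[OF pair_sym_arcs])
qed

lemma graph_dist_le_walk_length:
  assumes "awalk u p w"
  shows "graph_dist G u w \<le> real (length p)"
  using assms
  by (subst graph_dist_eq_shortest_walk)
     (auto intro!: Least_le reachable_awalkI wf_digraph_axioms)

lemma shortest_walkE:
  assumes "u \<in> pverts G" "w \<in> pverts G"
  obtains p where "awalk u p w" "graph_dist G u w = real (length p)"
proof -
  have reach: "u \<rightarrow>\<^sup>*\<^bsub>with_proj G\<^esub> w"
    by (rule reachable_if_verts[OF assms])
  then have ex: "\<exists>n p. awalk u p w \<and> length p = n"
    by (auto simp: reachable_awalk)
  show ?thesis
    using LeastI_ex[OF ex] graph_dist_eq_shortest_walk[OF wf_digraph_axioms reach] that by auto
qed

lemma graph_dist_nonneg: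
  assumes "u \<in> pverts G" "w \<in> pverts G"
  shows "0 \<le> graph_dist G u w"
  using shortest_walkE[OF assms] by (metis of_nat_0_le_iff)

lemma graph_dist_triangle:
  assumes "u \<in> pverts G" "w \<in> pverts G" "x \<in> pverts G"
  shows "graph_dist G u x \<le> graph_dist G u w + graph_dist G w x"
proof -
  obtain p where p: "awalk u p w" "graph_dist G u w = real (length p)"
    using shortest_walkE[OF assms(1,2)] .
  obtain q where q: "awalk w q x" "graph_dist G w x = real (length q)"
    using shortest_walkE[OF assms(2,3)] .
  have "awalk u (p @ q) x"
    using p q by auto
  from graph_dist_le_walk_length[OF this] p q show ?thesis by simp
qed

text \<open>
  Each arc \<open>(a, b)\<close> of a walk is replaced by its reverse \<open>(b, a)\<close>, which is an arc by symmetry.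
\<close>

lemma awalk_reverse:
  assumes "awalk u p w"
  shows "awalk w (rev (map prod.swap p)) u"
  using assms
proof (induction p arbitrary: u)
  case Nil
  then show ?case by (auto simp: awalk_simps)
next
  case (Cons e p)
  then have e: "e \<in> parcs G" "u = fst e" and rest: "awalk w (rev (map prod.swap p)) (snd e)"
    by (auto simp: awalk_simps)
  have "prod.swap e \<in> parcs G"
    using e(1) arcs_ends_symmetric[OF pair_sym_arcs, of "fst e" "snd e"]
    by (auto simp: prod.swap_def)
  then have "awalk (snd e) [prod.swap e] u"
    using e wellformed' by (auto simp: awalk_simps arc_fst_in_verts)
  then show ?case
    using awalk_appendI[OF rest] by simp
qed

lemma graph_dist_sym:
  assumes "u \<in> pverts G" "w \<in> pverts G"
  shows "graph_dist G u w = graph_dist G w u"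
proof -
  have "graph_dist G x y \<le> graph_dist G y x" if xy: "x \<in> pverts G" "y \<in> pverts G" for x y
  proof -
    obtain p where p: "awalk y p x" "graph_dist G y x = real (length p)"
      using shortest_walkE[OF xy(2,1)] .
    show ?thesis
      using graph_dist_le_walk_length[OF awalk_reverse[OF p(1)]] p(2) by simp
  qed
  then show ?thesis using assms by (simp add: antisym)
qed

lemma abs_graph_dist_diff_le:
  assumes "u \<in> pverts G" "w \<in> pverts G" "x \<in> pverts G"
  shows "\<bar>graph_dist G u x - graph_dist G w x\<bar> \<le> graph_dist G w u"
  using graph_dist_triangle[of u w x] graph_dist_triangle[of w u x] graph_dist_sym[of u w] assms
  by linarith

lemma graph_dist_diff_le:
  assumes "u \<in> pverts G" "w \<in> pverts G" "x \<in> pverts G"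
  shows "graph_dist G w u - graph_dist G w x \<le> graph_dist G u x"
  using graph_dist_triangle[of w x u] graph_dist_sym[of u x] assms
  by linarith

text \<open>
  By induction on the length: the first arc can be chosen in finitely many ways.
\<close>

lemma finite_walk_ends:
  assumes "u \<in> pverts G"
  shows "finite {w. \<exists>p. awalk u p w \<and> length p = n}"
  using assms
proof (induction n arbitrary: u)
  case 0
  have "{w. \<exists>p. awalk u p w \<and> length p = 0} \<subseteq> {u}"
    by (auto simp: awalk_simps)
  then show ?case
    by (rule finite_subset) simp
next
  case (Suc n)
  have "{w. \<exists>p. awalk u p w \<and> length p = Suc n}
      \<subseteq> (\<Union>e\<in>out_arcs (with_proj G) u. {w. \<exists>p. awalk (snd e) p w \<and> length p = n})"
    by (fastforce simp: length_Suc_conv awalk_simps out_arcs_def)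
  moreover have "finite (out_arcs (with_proj G) u)"
    using locally_finite Suc.prems by (auto simp: locally_finite_graph_def)
  then have "finite (\<Union>e\<in>out_arcs (with_proj G) u. {w. \<exists>p. awalk (snd e) p w \<and> length p = n})"
    by (intro finite_UN_I Suc.IH) (auto simp: out_arcs_def arc_snd_in_verts)
  ultimately show ?case
    by (rule finite_subset)
qed

lemma finite_ball:
  assumes "u \<in> pverts G"
  shows "finite {w \<in> pverts G. graph_dist G u w \<le> r}"
proof (rule finite_subset)
  show "{w \<in> pverts G. graph_dist G u w \<le> r}
      \<subseteq> (\<Union>n\<le>nat \<lfloor>r\<rfloor>. {w. \<exists>p. awalk u p w \<and> length p = n})"
  proof safe
    fix w assume w: "w \<in> pverts G" "graph_dist G u w \<le> r"
    obtain p where p: "awalk u p w" "graph_dist G u w = real (length p)"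
      using shortest_walkE[OF assms w(1)] .
    then have "length p \<le> nat \<lfloor>r\<rfloor>"
      using w(2) by (simp add: le_nat_floor)
    then show "w \<in> (\<Union>n\<le>nat \<lfloor>r\<rfloor>. {w. \<exists>p. awalk u p w \<and> length p = n})"
      using p(1) by blast
  qed
  show "finite (\<Union>n\<le>nat \<lfloor>r\<rfloor>. {w. \<exists>p. awalk u p w \<and> length p = n})"
    using finite_walk_ends[OF assms] by simp
qed

text \<open>
  Countability is what lets the distribution of a random vertex be recovered from its point masses.
\<close>

lemma countable_verts: "countable (pverts G)"
proof (cases "pverts G = {}")
  case False
  then obtain u where u: "u \<in> pverts G" by blast
  have "pverts G \<subseteq> (\<Union>n. {w \<in> pverts G. graph_dist G u w \<le> real n})"
    using real_arch_simple by blast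
  moreover have "countable (\<Union>n. {w \<in> pverts G. graph_dist G u w \<le> real n})"
    by (rule countable_UN) (auto intro: countable_finite finite_ball u)
  ultimately show ?thesis
    by (rule countable_subset)
qed simp

section \<open>Separation of sampled weights\<close>

text \<open>
  Any vertex sequence whose distances to \<open>v\<close> have converging averages is eventually better served
  by \<open>v\<close> than by all other vertices at once, provided that this holds for each other vertex in the
  limit. The radius \<open>2 c + 1\<close> leaves room for the averages, which end up below \<open>c + 1 / 2\<close>.
\<close>

lemma eventually_sum_sq_dist_less:
  fixes s :: "nat \<Rightarrow> 'v"
  assumes v: "v \<in> pverts G"
    and s: "\<And>i. i \<ge> 1 \<Longrightarrow> s i \<in> pverts G"
    and c: "(\<lambda>n. (\<Sum>i=1..n. graph_dist G v (s i)) / real n) \<longlonglongrightarrow> c"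
    and gap: "\<And>u. u \<in> pverts G \<Longrightarrow> u \<noteq> v \<Longrightarrow>
      \<exists>e>0. (\<lambda>n. (\<Sum>i=1..n. (graph_dist G u (s i))\<^sup>2 - (graph_dist G v (s i))\<^sup>2) / real n) \<longlonglongrightarrow> e"
  shows "\<forall>\<^sub>F n in sequentially. \<forall>u\<in>pverts G - {v}.
    (\<Sum>i=1..n. (graph_dist G v (s i))\<^sup>2) < (\<Sum>i=1..n. (graph_dist G u (s i))\<^sup>2)"
proof -
  let ?d = "graph_dist G"
  define B where "B = {u \<in> pverts G. ?d v u \<le> 2 * c + 1}"
  have c_nonneg: "0 \<le> c"
    using s v
    by (intro tendsto_lowerbound[OF c]) (auto intro!: always_eventually divide_nonneg_nonneg sum_nonneg graph_dist_nonneg)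
  have "\<forall>\<^sub>F n in sequentially. \<forall>u\<in>B - {v}.
      0 < (\<Sum>i=1..n. (?d u (s i))\<^sup>2 - (?d v (s i))\<^sup>2) / real n"
  proof (rule eventually_ball_finite)
    show "finite (B - {v})"
      unfolding B_def using finite_ball[OF v] by simp
    show "\<forall>u\<in>B - {v}. \<forall>\<^sub>F n in sequentially. 0 < (\<Sum>i=1..n. (?d u (s i))\<^sup>2 - (?d v (s i))\<^sup>2) / real n"
      using gap order_tendstoD(1) unfolding B_def by fast
  qed
  moreover have "\<forall>\<^sub>F n in sequentially. (\<Sum>i=1..n. ?d v (s i)) / real n < c + 1 / 2"
    using order_tendstoD(2)[OF c, of "c + 1 / 2"] by simp
  ultimately show ?thesis
    using eventually_gt_at_top[of 0]
  proof eventually_elim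
    case (elim n)
    show ?case
    proof
      fix u assume u: "u \<in> pverts G - {v}"
      have "0 < (\<Sum>i=1..n. (?d u (s i))\<^sup>2 - (?d v (s i))\<^sup>2)"
      proof (cases "u \<in> B")
        case True
        then show ?thesis
          using elim u by (auto simp: zero_less_divide_iff)
      next
        case False
        define D where "D = ?d v u"
        have D: "2 * c + 1 < D"
          using False u by (auto simp: B_def D_def)
        have "(\<Sum>i=1..n. ?d v (s i)) < (c + 1 / 2) * real n"
          using elim by (simp add: pos_divide_less_eq)
        also have "\<dots> \<le> D / 2 * real n"
          using D by (intro mult_right_mono) auto
        finally have "0 < D * (real n * D - 2 * (\<Sum>i=1..n. ?d v (s i)))"
          using D c_nonneg by (intro mult_pos_pos) (auto simp: mult.commute)
        also have "\<dots> = (\<Sum>i=1..n. D * (D - 2 * ?d v (s i)))"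
          by (simp add: sum_subtractf right_diff_distrib flip: sum_distrib_left)
        also have "\<dots> \<le> (\<Sum>i=1..n. (?d u (s i))\<^sup>2 - (?d v (s i))\<^sup>2)"
        proof (rule sum_mono)
          fix i assume i: "i \<in> {1..n}"
          have "\<bar>D - ?d v (s i)\<bar> \<le> \<bar>?d u (s i)\<bar>"
            using graph_dist_diff_le[of u v "s i"] graph_dist_triangle[of v u "s i"]
              graph_dist_nonneg[of u "s i"] u v i s[of i]
            unfolding D_def by auto
          then have "(D - ?d v (s i))\<^sup>2 \<le> (?d u (s i))\<^sup>2"
            by (simp only: abs_le_square_iff)
          then show "D * (D - 2 * ?d v (s i)) \<le> (?d u (s i))\<^sup>2 - (?d v (s i))\<^sup>2"
            by (simp add: power2_eq_square algebra_simps)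
        qed
        finally show ?thesis .
      qed
      then show "(\<Sum>i=1..n. (?d v (s i))\<^sup>2) < (\<Sum>i=1..n. (?d u (s i))\<^sup>2)"
        by (simp add: sum_subtractf)
    qed
  qed
qed

end

section \<open>Weights as averages and as expectations\<close>

text \<open>
  The empirical frequencies vanish off the finite set of sampled vertices, and grouping the sample
  by value turns the sum over vertices into a sum over the sample.
\<close>

lemma weight_sample_freq:
  assumes "\<And>i. i \<in> {1..n} \<Longrightarrow> \<xi> i \<omega> \<in> pverts G"
  shows "weight G (sample_freq \<xi> n \<omega>) u = ennreal ((\<Sum>i=1..n. (graph_dist G u (\<xi> i \<omega>))\<^sup>2) / real n)"
proof -
  define F where "F = (\<lambda>i. \<xi> i \<omega>) ` {1..n}"
  let ?g = "\<lambda>s. (graph_dist G u s)\<^sup>2"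
  have F: "finite F" "F \<subseteq> pverts G"
    using assms by (auto simp: F_def)
  have outside: "sample_freq \<xi> n \<omega> s = 0" if "s \<notin> F" for s
  proof -
    have "{i \<in> {1..n}. \<xi> i \<omega> = s} = {}"
      using that by (auto simp: F_def)
    then show ?thesis
      by (simp add: sample_freq_def del: atLeastAtMost_iff)
  qed
  have "weight G (sample_freq \<xi> n \<omega>) u = (\<Sum>\<^sub>\<infinity>s\<in>F. ennreal (?g s * sample_freq \<xi> n \<omega> s))"
    unfolding weight_def using F outside by (intro infsum_cong_neutral) auto
  also have "\<dots> = ennreal (\<Sum>s\<in>F. ?g s * sample_freq \<xi> n \<omega> s)"
    using F by (simp add: sum_ennreal sample_freq_def)
  also have "(\<Sum>s\<in>F. ?g s * sample_freq \<xi> n \<omega> s)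
      = (\<Sum>s\<in>F. \<Sum>i\<in>{i \<in> {1..n}. \<xi> i \<omega> = s}. ?g (\<xi> i \<omega>)) / real n"
    by (simp add: sum_divide_distrib sample_freq_def mult.commute)
  also have "(\<Sum>s\<in>F. \<Sum>i\<in>{i \<in> {1..n}. \<xi> i \<omega> = s}. ?g (\<xi> i \<omega>)) = (\<Sum>i=1..n. ?g (\<xi> i \<omega>))"
    unfolding F_def by (rule sum.image_gen[symmetric]) simp
  finally show ?thesis .
qed

lemma infsum_eq_nn_integral_count_space:
  fixes f :: "'i \<Rightarrow> ennreal"
  assumes "countable A"
  shows "infsum f A = (\<integral>\<^sup>+x. f x \<partial>count_space A)"
proof (cases "finite A")
  case True
  then show ?thesis by (simp add: nn_integral_count_space_finite)
next
  case False
  have bij: "bij_betw (from_nat_into A) UNIV A"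
    by (rule bij_betw_from_nat_into[OF assms False])
  have "infsum f A = infsum (\<lambda>n. f (from_nat_into A n)) UNIV"
    by (rule infsum_reindex_bij_betw[OF bij, symmetric])
  also have "\<dots> = (\<Sum>n. f (from_nat_into A n))"
    by (intro sums_unique has_sum_imp_sums has_sum_infsum nonneg_summable_on_complete) simp
  also have "\<dots> = (\<integral>\<^sup>+x. f x \<partial>count_space A)"
    by (simp flip: nn_integral_count_space_nat nn_integral_bij_count_space[OF bij])
  finally show ?thesis .
qed

text \<open>
  The square distance to \<open>\<xi>\<close> is the sum over all vertices \<open>s\<close> of the square distance to
  \<open>s\<close> on the event \<open>\<xi> = s\<close>. Summation and integration may be exchanged as there are only
  countably many vertices.
\<close>

lemma (in prob_space) weight_element_dist:
  assumes V: "countable (pverts G)"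
    and \<xi> [measurable]: "\<xi> \<in> measurable M (count_space (pverts G))"
  shows "weight G (element_dist M \<xi>) u = (\<integral>\<^sup>+x. ennreal ((graph_dist G u (\<xi> x))\<^sup>2) \<partial>M)"
proof -
  let ?g = "\<lambda>s. ennreal ((graph_dist G u s)\<^sup>2)"
  have sets [measurable]: "{x \<in> space M. \<xi> x = s} \<in> sets M" if "s \<in> pverts G" for s
    using measurable_sets[OF \<xi>, of "{s}"] that by (simp add: vimage_def Int_def conj_commute)
  have "(\<integral>\<^sup>+x. ?g (\<xi> x) \<partial>M)
      = (\<integral>\<^sup>+x. \<integral>\<^sup>+s. ?g s * indicator {x \<in> space M. \<xi> x = s} x \<partial>count_space (pverts G) \<partial>M)"
  proof (rule nn_integral_cong)
    fix x assume x: "x \<in> space M"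
    then have mem: "\<xi> x \<in> pverts G"
      using measurable_space[OF \<xi>] by simp
    have "(\<integral>\<^sup>+s. ?g s * indicator {x \<in> space M. \<xi> x = s} x \<partial>count_space (pverts G))
        = (\<integral>\<^sup>+s. ?g s * indicator {\<xi> x} s \<partial>count_space (pverts G))"
      using x by (intro nn_integral_cong) (auto simp: indicator_def)
    also have "\<dots> = ?g (\<xi> x)"
      using mem by (subst nn_integral_indicator_singleton) auto
    finally show "?g (\<xi> x) = (\<integral>\<^sup>+s. ?g s * indicator {x \<in> space M. \<xi> x = s} x \<partial>count_space (pverts G))"
      by simp
  qed
  also have "\<dots> = (\<integral>\<^sup>+s. \<integral>\<^sup>+x. ?g s * indicator {x \<in> space M. \<xi> x = s} x \<partial>M \<partial>count_space (pverts G))"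
    by (rule nn_integral_count_space_nn_integral[OF V]) (auto intro!: borel_measurable_times borel_measurable_indicator sets)
  also have "\<dots> = (\<integral>\<^sup>+s. ennreal ((graph_dist G u s)\<^sup>2 * element_dist M \<xi> s) \<partial>count_space (pverts G))"
    by (intro nn_integral_cong)
       (simp add: nn_integral_cmult_indicator sets element_dist_def emeasure_eq_measure ennreal_mult)
  also have "\<dots> = weight G (element_dist M \<xi>) u"
    unfolding weight_def by (rule infsum_eq_nn_integral_count_space[OF V, symmetric])
  finally show ?thesis by simp
qed

section \<open>Convergence of sample mean-sets\<close>

theorem theoremA:
  fixes G :: "'v pair_pre_digraph"
    and P :: "'w measure"
    and \<xi> :: "nat \<Rightarrow> 'w \<Rightarrow> 'v"
    and v :: 'v
  assumes "pair_sym_digraph G"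
    and "locally_finite_graph G"
    and "Digraph_Component.connected (with_proj G)"
    and "prob_space P"
    and "prob_space.indep_vars P (\<lambda>_. count_space (pverts G)) \<xi> {1..}"
    and "\<forall>i \<ge> 1. distr P (count_space (pverts G)) (\<xi> i) = distr P (count_space (pverts G)) (\<xi> 1)"
    and "weight_totally_defined G P (\<xi> 1)"
    and "v \<in> pverts G"
    and "mean_set G P (\<xi> 1) = {v}"
  shows "AE \<omega> in P.
    limsup (\<lambda>n. sample_mean_set G \<xi> n \<omega>) = mean_set G P (\<xi> 1) \<and>
    liminf (\<lambda>n. sample_mean_set G \<xi> n \<omega>) = mean_set G P (\<xi> 1)"
proof -
  interpret prob_space P by fact
  interpret locally_finite_connected_graph G
    by (intro locally_finite_connected_graph.intro locally_finite_connected_graph_axioms.intro assms)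
  let ?V = "pverts G" and ?d = "graph_dist G"
  note v = \<open>v \<in> ?V\<close>
  note indep = assms(5)
  have ident: "distr P (count_space ?V) (\<xi> i) = distr P (count_space ?V) (\<xi> 1)" if "i \<ge> 1" for i
    using assms(6) that by blast
  have \<xi>: "\<xi> i \<in> measurable P (count_space ?V)" if "i \<ge> 1" for i
    using indep that by (auto simp: indep_vars_def)
  have \<xi>_in: "\<xi> i \<omega> \<in> ?V" if "i \<ge> 1" "\<omega> \<in> space P" for i \<omega>
    using measurable_space[OF \<xi>] that by simp
  have meas1: "(\<lambda>\<omega>. h (\<xi> 1 \<omega>)) \<in> borel_measurable P" for h :: "'v \<Rightarrow> real"
    by (rule measurable_compose[OF \<xi>]) auto
  have weight_eq: "weight G (element_dist P (\<xi> 1)) u = (\<integral>\<^sup>+\<omega>. ennreal ((?d u (\<xi> 1 \<omega>))\<^sup>2) \<partial>P)" for u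
    by (rule weight_element_dist[OF countable_verts \<xi>]) simp
  have sq_int: "integrable P (\<lambda>\<omega>. (?d u (\<xi> 1 \<omega>))\<^sup>2)" if "u \<in> ?V" for u
    using assms(7) that weight_eq[of u] meas1[of "\<lambda>s. (?d u s)\<^sup>2"]
    by (auto simp: weight_totally_defined_def integrable_iff_bounded)
  have weight_exp: "weight G (element_dist P (\<xi> 1)) u = ennreal (expectation (\<lambda>\<omega>. (?d u (\<xi> 1 \<omega>))\<^sup>2))"
    if "u \<in> ?V" for u
    using nn_integral_eq_integral[OF sq_int[OF that]] weight_eq[of u] by simp
  define f where "f u s = (?d u s)\<^sup>2 - (?d v s)\<^sup>2" for u s
  have f_exp: "0 < expectation (\<lambda>\<omega>. f u (\<xi> 1 \<omega>))" if u: "u \<in> ?V" "u \<noteq> v" for u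
  proof -
    have "v \<in> mean_set G P (\<xi> 1)" "u \<notin> mean_set G P (\<xi> 1)"
      using assms(9) u by auto
    then have "weight G (element_dist P (\<xi> 1)) v < weight G (element_dist P (\<xi> 1)) u"
      using u(1) unfolding mean_set_def weight_minimizers_def
      by (auto simp: not_le intro: le_less_trans)
    then have "expectation (\<lambda>\<omega>. (?d v (\<xi> 1 \<omega>))\<^sup>2) < expectation (\<lambda>\<omega>. (?d u (\<xi> 1 \<omega>))\<^sup>2)"
      unfolding weight_exp[OF v] weight_exp[OF u(1)] by (simp add: ennreal_less_iff)
    then show ?thesis
      unfolding f_def using sq_int[OF v] sq_int[OF u(1)] by simp
  qed
  \<comment> \<open>In \<open>f u = (d u - d v) (d u + d v)\<close> the first factor is at most \<open>d v u\<close> in absolute value and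
    the second one is square integrable.\<close>
  have f_sq_int: "integrable P (\<lambda>\<omega>. (f u (\<xi> 1 \<omega>))\<^sup>2)" if u: "u \<in> ?V" for u
  proof (rule Bochner_Integration.integrable_bound)
    let ?D = "?d v u"
    show "integrable P (\<lambda>\<omega>. 2 * ?D\<^sup>2 * ((?d u (\<xi> 1 \<omega>))\<^sup>2 + (?d v (\<xi> 1 \<omega>))\<^sup>2))"
      using sq_int[OF u] sq_int[OF v] by (intro integrable_mult_right) simp
    show "(\<lambda>\<omega>. (f u (\<xi> 1 \<omega>))\<^sup>2) \<in> borel_measurable P"
      by (rule meas1)
    show "AE \<omega> in P. norm ((f u (\<xi> 1 \<omega>))\<^sup>2)
        \<le> norm (2 * ?D\<^sup>2 * ((?d u (\<xi> 1 \<omega>))\<^sup>2 + (?d v (\<xi> 1 \<omega>))\<^sup>2))"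
    proof (rule AE_I2)
      fix \<omega> assume "\<omega> \<in> space P"
      define a b where "a = ?d u (\<xi> 1 \<omega>)" and "b = ?d v (\<xi> 1 \<omega>)"
      have "\<bar>a - b\<bar> \<le> \<bar>?D\<bar>"
        unfolding a_def b_def using abs_graph_dist_diff_le[OF u v \<xi>_in[OF _ \<open>\<omega> \<in> space P\<close>], of 1] by simp
      then have "(a - b)\<^sup>2 \<le> ?D\<^sup>2"
        by (simp only: abs_le_square_iff)
      moreover have "(a + b)\<^sup>2 \<le> 2 * (a\<^sup>2 + b\<^sup>2)"
        using zero_le_power2[of "a - b"] by (simp add: power2_eq_square algebra_simps)
      ultimately have "(a - b)\<^sup>2 * (a + b)\<^sup>2 \<le> ?D\<^sup>2 * (2 * (a\<^sup>2 + b\<^sup>2))"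
        by (intro mult_mono) auto
      also have "(a - b)\<^sup>2 * (a + b)\<^sup>2 = (f u (\<xi> 1 \<omega>))\<^sup>2"
        by (simp add: f_def a_def b_def power2_eq_square algebra_simps)
      finally show "norm ((f u (\<xi> 1 \<omega>))\<^sup>2)
          \<le> norm (2 * ?D\<^sup>2 * ((?d u (\<xi> 1 \<omega>))\<^sup>2 + (?d v (\<xi> 1 \<omega>))\<^sup>2))"
        by (simp add: a_def b_def algebra_simps)
    qed
  qed
  have "AE \<omega> in P. (\<lambda>n. (\<Sum>i=1..n. ?d v (\<xi> i \<omega>)) / real n) \<longlonglongrightarrow> expectation (\<lambda>\<omega>. ?d v (\<xi> 1 \<omega>))"
    by (rule strong_law_iid[OF indep ident _ sq_int[OF v]]) auto
  moreover have "AE \<omega> in P. \<forall>u\<in>?V. (\<lambda>n. (\<Sum>i=1..n. f u (\<xi> i \<omega>)) / real n)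
      \<longlonglongrightarrow> expectation (\<lambda>\<omega>. f u (\<xi> 1 \<omega>))"
  proof (rule AE_ball_countable'[OF _ countable_verts])
    fix u assume "u \<in> ?V"
    then show "AE \<omega> in P. (\<lambda>n. (\<Sum>i=1..n. f u (\<xi> i \<omega>)) / real n) \<longlonglongrightarrow> expectation (\<lambda>\<omega>. f u (\<xi> 1 \<omega>))"
      by (intro strong_law_iid[OF indep ident _ f_sq_int]) auto
  qed
  ultimately show ?thesis
    using AE_space
  proof eventually_elim
    case (elim \<omega>)
    have "\<forall>\<^sub>F n in sequentially. \<forall>u\<in>?V - {v}.
        (\<Sum>i=1..n. (?d v (\<xi> i \<omega>))\<^sup>2) < (\<Sum>i=1..n. (?d u (\<xi> i \<omega>))\<^sup>2)"
    proof (rule eventually_sum_sq_dist_less[OF v _ elim(1)])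
      show "\<xi> i \<omega> \<in> ?V" if "i \<ge> 1" for i
        using \<xi>_in that elim by blast
      show "\<exists>e>0. (\<lambda>n. (\<Sum>i=1..n. (?d u (\<xi> i \<omega>))\<^sup>2 - (?d v (\<xi> i \<omega>))\<^sup>2) / real n) \<longlonglongrightarrow> e"
        if "u \<in> ?V" "u \<noteq> v" for u
        using f_exp[OF that] elim(2) that(1) unfolding f_def by blast
    qed
    then have ev: "\<forall>\<^sub>F n in sequentially. sample_mean_set G \<xi> n \<omega> = {v}"
      using eventually_gt_at_top[of 0]
    proof eventually_elim
      case (elim n)
      have "weight G (sample_freq \<xi> n \<omega>) v < weight G (sample_freq \<xi> n \<omega>) u" if "u \<in> ?V" "u \<noteq> v" for u
      proof -
        have eq: "weight G (sample_freq \<xi> n \<omega>) x = ennreal ((\<Sum>i=1..n. (?d x (\<xi> i \<omega>))\<^sup>2) / real n)" for x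
          using \<xi>_in \<open>\<omega> \<in> space P\<close> by (intro weight_sample_freq) auto
        have "(\<Sum>i=1..n. (?d v (\<xi> i \<omega>))\<^sup>2) / real n < (\<Sum>i=1..n. (?d u (\<xi> i \<omega>))\<^sup>2) / real n"
          using elim that by (intro divide_strict_right_mono) auto
        then show ?thesis
          unfolding eq by (subst ennreal_less_iff) (auto intro!: divide_nonneg_nonneg sum_nonneg)
      qed
      then show ?case
        using v unfolding sample_mean_set_def weight_minimizers_def
        by (auto simp: not_le intro: less_imp_le) (metis not_le)
    qed
    have "limsup (\<lambda>n. sample_mean_set G \<xi> n \<omega>) = {v}"
      using ev by (subst Limsup_eq[OF ev]) (simp add: Limsup_const)
    moreover have "liminf (\<lambda>n. sample_mean_set G \<xi> n \<omega>) = {v}"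
      using ev by (subst Liminf_eq[OF ev]) (simp add: Liminf_const)
    ultimately show ?case
      using assms(9) by simp
  qed
qed

end
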